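(* Let $\alpha,\beta\in\mathbb{Z}^s$ be two linearly independent vectors, each having both positive and negative entries, such that $\gamma=\alpha+\beta$ also has both positive and negative entries. Then, in $\mathbb{K}[x_1,\ldots,x_s]$, $$x^{\gamma_+}-x^{\gamma_-}\in\langle x^{\alpha_+}-x^{\alpha_-},\; x^{\beta_+}-x^{\beta_-}\rangle$$ if and only if $\operatorname{supp}(\alpha_+)\cap\operatorname{supp}(\beta_-)=\emptyset$ or $\operatorname{supp}(\alpha_-)\cap\operatorname{supp}(\beta_+)=\emptyset$.
   Context: $\mathbb{K}$ is an algebraically closed field of characteristic zero. For $\alpha=(a_1,\ldots,a_s)\in\mathbb{Z}^s$, $\operatorname{supp}(\alpha)=\{i : a_i\neq 0\}$, and $\alpha=\alpha_+-\alpha_-$ with $\alpha_+=\sum_{a_i>0}a_i\mathbf{e}_i$ and $\alpha_-=\sum_{a_i<0}(-a_i)\mathbf{e}_i$, where $\mathbf{e}_i$ are the standard basis vectors. For $u\in\mathbb{N}^s$, $x^u=x_1^{u_1}\cdots x_s^{u_s}$. *)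

theory Defs
  imports
    "HOL-Analysis.Finite_Cartesian_Product"
    "HOL-Computational_Algebra.Polynomial"
    "HOL-Library.Poly_Mapping"
begin

text \<open>
  Polynomials over \<open>'k\<close> in variables indexed by the finite type \<open>'n\<close>, as finitely supported
  maps from exponents to coefficients; the multiplication of \<^theory>\<open>HOL-Library.Poly_Mapping\<close>
  is convolution, so this is the polynomial ring in \<open>s = CARD('n)\<close> variables.
\<close>

type_synonym ('n, 'k) mpoly = "('n \<Rightarrow>\<^sub>0 nat) \<Rightarrow>\<^sub>0 'k"

definition var :: "'n \<Rightarrow> ('n, 'k::comm_ring_1) mpoly" where
  "var i = Poly_Mapping.single (Poly_Mapping.single i 1) 1"

definition monomial :: "nat ^ 'n \<Rightarrow> ('n::finite, 'k::comm_ring_1) mpoly" where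
  "monomial u = (\<Prod>i\<in>UNIV. var i ^ (u $ i))"

definition pos_part :: "int ^ 'n \<Rightarrow> nat ^ 'n" where
  "pos_part \<alpha> = (\<chi> i. if \<alpha> $ i > 0 then nat (\<alpha> $ i) else 0)"

definition neg_part :: "int ^ 'n \<Rightarrow> nat ^ 'n" where
  "neg_part \<alpha> = (\<chi> i. if \<alpha> $ i < 0 then nat (- (\<alpha> $ i)) else 0)"

lemma pos_part_minus_neg_part:
  "\<alpha> $ i = int (pos_part \<alpha> $ i) - int (neg_part \<alpha> $ i)"
  by (simp add: pos_part_def neg_part_def)

definition supp :: "'a::zero ^ 'n \<Rightarrow> 'n set" where
  "supp v = {i. v $ i \<noteq> 0}"

text \<open>
  Ideals of a commutative ring are its submodules over itself, so \<open>ideal.span S\<close> is the ideal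
  generated by \<open>S\<close>.
\<close>

global_interpretation ideal: module "(*) :: 'a::comm_ring_1 \<Rightarrow> 'a \<Rightarrow> 'a"
  by (standard; rule distrib_left distrib_right mult.assoc[symmetric] mult_1_left)

text \<open>As a simp rule, \<open>a * (b * x) = a * b * x\<close> would loop with \<open>algebra_simps\<close>.\<close>

declare ideal.scale_scale [simp del]

global_interpretation int_vec: module "(*s) :: int \<Rightarrow> int ^ 'n \<Rightarrow> int ^ 'n"
  by (standard; simp add: vec_eq_iff distrib_left distrib_right)

end

theory Submission
  imports Defs
begin

text \<open>
  If the supports of \<open>\<alpha>\<^sub>+\<close> and \<open>\<beta>\<^sub>-\<close> are disjoint, then \<open>\<alpha>\<^sub>+ \<le> \<gamma>\<^sub>+\<close> and \<open>\<beta>\<^sub>- \<le> \<gamma>\<^sub>-\<close>, so one \<open>\<alpha>\<close>-move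
  followed by one \<open>\<beta>\<close>-move leads from \<open>\<gamma>\<^sub>+\<close> to \<open>\<gamma>\<^sub>-\<close>. Conversely, suppose that both intersections are
  nonempty, and let \<open>S\<close> be the set of exponents of the form \<open>\<gamma>\<^sub>+ + m \<alpha> + n \<beta>\<close> with \<open>n \<ge> 0\<close>. The sum
  of the coefficients at the exponents in \<open>S\<close> is a linear functional. It vanishes on the ideal,
  because \<open>S\<close> is closed under all moves: a move from \<open>n = 0\<close> to \<open>n = -1\<close> would need
  \<open>\<gamma>\<^sub>+ + m \<alpha> \<ge> \<beta>\<^sub>+\<close>, which forces \<open>m \<ge> 0\<close> at an index with \<open>\<alpha> > 0 > \<beta>\<close> and \<open>m < 0\<close> at an index
  with \<open>\<alpha> < 0 < \<beta>\<close>. But \<open>\<gamma>\<^sub>+\<close> lies in \<open>S\<close> and, by linear independence, \<open>\<gamma>\<^sub>-\<close> does not.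
\<close>

definition expo :: "nat ^ 'n \<Rightarrow> ('n::finite \<Rightarrow>\<^sub>0 nat)" where
  "expo u = (\<Sum>i\<in>UNIV. Poly_Mapping.single i (u $ i))"

lemma lookup_expo [simp]: "Poly_Mapping.lookup (expo u) i = u $ i"
proof -
  have "Poly_Mapping.lookup (expo u) i = (\<Sum>j\<in>UNIV. if j = i then u $ j else 0)"
    unfolding expo_def lookup_sum by (intro sum.cong) (simp_all add: lookup_single when_def)
  then show ?thesis by simp
qed

lemma var_power:
  "var i ^ k = (Poly_Mapping.single (Poly_Mapping.single i k) 1 :: ('n, 'k::comm_ring_1) mpoly)"
  by (induction k) (simp_all add: var_def mult_single flip: single_add)

lemma prod_single_one:
  "finite A \<Longrightarrow> (\<Prod>i\<in>A. Poly_Mapping.single (f i) 1) =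
    (Poly_Mapping.single (\<Sum>i\<in>A. f i) 1 :: 'a::comm_monoid_add \<Rightarrow>\<^sub>0 'k::comm_ring_1)"
  by (induction A rule: finite_induct) (simp_all add: mult_single)

text \<open>In this form each monomial has one visible exponent, on which \<open>coeff_sum\<close>
  can be evaluated.\<close>

lemma monomial_eq_single: "monomial u = Poly_Mapping.single (expo u) 1"
  by (simp add: monomial_def var_power prod_single_one expo_def)

lemma monomial_add: "monomial (u + v) = monomial u * monomial v"
  by (simp add: monomial_def power_add prod.distrib)

lemma binomial_in_span_if_le:
  fixes \<alpha> \<beta> :: "int ^ 'n::finite"
  assumes "\<And>i. pos_part \<alpha> $ i \<le> p $ i" "\<And>i. neg_part \<beta> $ i \<le> q $ i"
    and "\<And>i. int (p $ i) - int (q $ i) = \<alpha> $ i + \<beta> $ i"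
  shows "monomial p - monomial q
    \<in> ideal.span {monomial (pos_part \<alpha>) - monomial (neg_part \<alpha>) :: ('n, 'k::comm_ring_1) mpoly,
                  monomial (pos_part \<beta>) - monomial (neg_part \<beta>)}"
proof -
  let ?m = "monomial :: _ \<Rightarrow> ('n, 'k) mpoly"
  \<comment> \<open>The first two hypotheses keep these subtractions of naturals from
    truncating.\<close>
  define a where "a = p - pos_part \<alpha>"
  define b where "b = q - neg_part \<beta>"
  have p: "p = a + pos_part \<alpha>" and q: "q = b + neg_part \<beta>"
    using assms(1,2) by (simp_all add: a_def b_def vec_eq_iff)
  \<comment> \<open>The \<alpha>-move from \<open>p\<close> and the reversed \<beta>-move from
    \<open>q\<close> meet at one exponent, so the middle terms below cancel.\<close>
  have mid: "a + neg_part \<alpha> = b + pos_part \<beta>"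
  proof (simp add: vec_eq_iff, intro allI)
    fix i
    show "a $ i + neg_part \<alpha> $ i = b $ i + pos_part \<beta> $ i"
      using assms(3)[of i] pos_part_minus_neg_part[of \<alpha> i] pos_part_minus_neg_part[of \<beta> i]
      unfolding p q by simp
  qed
  have "?m p - ?m q = ?m a * (?m (pos_part \<alpha>) - ?m (neg_part \<alpha>))
      + ?m b * (?m (pos_part \<beta>) - ?m (neg_part \<beta>))"
    using arg_cong[OF mid, of ?m]
    by (simp add: p q monomial_add right_diff_distrib)
  then show ?thesis
    by (simp add: ideal.span_add ideal.span_scale ideal.span_base)
qed

text \<open>Summing over the keys of \<open>p\<close> keeps the sum finite even when
  \<open>S\<close> is infinite.\<close>

definition coeff_sum :: "'a set \<Rightarrow> ('a \<Rightarrow>\<^sub>0 'k::comm_ring_1) \<Rightarrow> 'k" where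
  "coeff_sum S p = (\<Sum>w\<in>Poly_Mapping.keys p. if w \<in> S then Poly_Mapping.lookup p w else 0)"

text \<open>Polynomials with different keys can thus share one index set, which yields
  additivity.\<close>

lemma coeff_sum_superset:
  assumes "finite A" "Poly_Mapping.keys p \<subseteq> A"
  shows "coeff_sum S p = (\<Sum>w\<in>A. if w \<in> S then Poly_Mapping.lookup p w else 0)"
  unfolding coeff_sum_def using assms
  by (intro sum.mono_neutral_left) (auto simp: in_keys_iff)

lemma coeff_sum_add: "coeff_sum S (p + q) = coeff_sum S p + coeff_sum S q"
proof -
  let ?A = "Poly_Mapping.keys p \<union> Poly_Mapping.keys q"
  have "coeff_sum S r = (\<Sum>w\<in>?A. if w \<in> S then Poly_Mapping.lookup r w else 0)"
    if "Poly_Mapping.keys r \<subseteq> ?A" for r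
    using that by (intro coeff_sum_superset) auto
  from this[of "p + q"] this[of p] this[of q] show ?thesis
    by (simp add: Poly_Mapping.keys_add sum.distrib[symmetric]) (intro sum.cong refl, simp add: lookup_add)
qed

lemma coeff_sum_diff: "coeff_sum S (p - q) = coeff_sum S p - coeff_sum S q"
  using coeff_sum_add[of S "p - q" q] by simp

lemma coeff_sum_single: "coeff_sum S (Poly_Mapping.single w c) = (if w \<in> S then c else 0)"
  by (simp add: coeff_sum_def)

text \<open>By additivity a single term of \<open>p\<close> suffices: it contributes
  \<open>c\<close> at \<open>w + a\<close> and \<open>- c\<close> at \<open>w + b\<close>, and
  \<open>S\<close> contains both exponents or neither.\<close>

lemma coeff_sum_mult_binomial:
  fixes p :: "'a::comm_monoid_add \<Rightarrow>\<^sub>0 'k::comm_ring_1"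
  assumes "\<And>w. w + a \<in> S \<longleftrightarrow> w + b \<in> S"
  shows "coeff_sum S (p * (Poly_Mapping.single a 1 - Poly_Mapping.single b 1)) = 0"
proof (induction p rule: Poly_Mapping.update_induct)
  case const
  then show ?case by (simp add: coeff_sum_def)
next
  case (update p w c)
  \<comment> \<open>The induction only adds a fresh key \<open>w\<close>, so no old coefficient is
    overwritten.\<close>
  have "Poly_Mapping.update w c p = p + Poly_Mapping.single w c"
    using update(1)
    by (intro poly_mapping_eqI) (auto simp: lookup_update lookup_add lookup_single in_keys_iff when_def)
  then show ?case
    using update assms[of w]
    by (simp add: distrib_right coeff_sum_add right_diff_distrib mult_single coeff_sum_diff coeff_sum_single)
qed

lemma coeff_sum_ideal_span:
  fixes p :: "'a::comm_monoid_add \<Rightarrow>\<^sub>0 'k::comm_ring_1"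
  assumes "p \<in> ideal.span {Poly_Mapping.single a 1 - Poly_Mapping.single b 1,
                           Poly_Mapping.single c 1 - Poly_Mapping.single d 1}"
    and "\<And>w. w + a \<in> S \<longleftrightarrow> w + b \<in> S" and "\<And>w. w + c \<in> S \<longleftrightarrow> w + d \<in> S"
  shows "coeff_sum S p = 0"
proof -
  obtain k l where "p - k * (Poly_Mapping.single a 1 - Poly_Mapping.single b 1)
      = l * (Poly_Mapping.single c 1 - Poly_Mapping.single d 1)"
    using assms(1) by (auto simp: ideal.span_insert ideal.span_singleton)
  then have "p = k * (Poly_Mapping.single a 1 - Poly_Mapping.single b 1)
      + l * (Poly_Mapping.single c 1 - Poly_Mapping.single d 1)"
    by (simp add: diff_eq_eq add.commute)
  then show ?thesis
    by (simp add: coeff_sum_add coeff_sum_mult_binomial assms(2,3))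
qed

lemma int_vec_independent_pairD:
  fixes \<alpha> \<beta> :: "int ^ 'n::finite"
  assumes "\<alpha> \<noteq> \<beta>" "int_vec.independent {\<alpha>, \<beta>}"
    and "\<And>i. m * \<alpha> $ i + n * \<beta> $ i = 0"
  shows "n = 0"
proof (rule ccontr)
  assume "n \<noteq> 0"
  \<comment> \<open>As \<alpha> and \<beta> differ, one function of the vector can carry both
    coefficients.\<close>
  let ?u = "\<lambda>v. if v = \<alpha> then m else n"
  have "(\<Sum>v\<in>{\<alpha>, \<beta>}. ?u v *s v) = 0"
    using assms(1) assms(3) by (subst sum.insert) (auto simp: vec_eq_iff)
  then have "?u \<beta> = 0"
    using int_vec.independentD[OF assms(2), of "{\<alpha>, \<beta>}" ?u \<beta>] by simp
  with \<open>n \<noteq> 0\<close> assms(1) show False by simp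
qed

lemma binomial_notin_span:
  fixes \<alpha> \<beta> :: "int ^ 'n::finite"
  assumes "\<alpha> \<noteq> \<beta>" "int_vec.independent {\<alpha>, \<beta>}"
    and i: "\<alpha> $ i > 0" "\<beta> $ i < 0" and j: "\<alpha> $ j < 0" "\<beta> $ j > 0"
  shows "(monomial (pos_part (\<alpha> + \<beta>)) - monomial (neg_part (\<alpha> + \<beta>)) :: ('n, 'k::comm_ring_1) mpoly)
    \<notin> ideal.span {monomial (pos_part \<alpha>) - monomial (neg_part \<alpha>),
                  monomial (pos_part \<beta>) - monomial (neg_part \<beta>)}"
proof
  let ?f = "monomial (pos_part (\<alpha> + \<beta>)) - monomial (neg_part (\<alpha> + \<beta>)) :: ('n, 'k) mpoly"
  assume mem: "?f \<in> ideal.span {monomial (pos_part \<alpha>) - monomial (neg_part \<alpha>),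
                  monomial (pos_part \<beta>) - monomial (neg_part \<beta>)}"
  define g where "g = pos_part (\<alpha> + \<beta>)"
  define reach where "reach w m n \<longleftrightarrow>
    (\<forall>k. int (Poly_Mapping.lookup w k) = int (g $ k) + m * \<alpha> $ k + n * \<beta> $ k)"
    for w :: "'n \<Rightarrow>\<^sub>0 nat" and m n
  \<comment> \<open>With \<open>m\<close> free to take either sign, \<alpha>-moves cannot leave
    \<open>S\<close>; only the boundary \<open>n = 0\<close> needs care.\<close>
  define S where "S = {w. \<exists>m n. n \<ge> 0 \<and> reach w m n}"
  have \<alpha>_move: "reach (w + expo (neg_part \<alpha>)) (m - 1) n \<longleftrightarrow> reach (w + expo (pos_part \<alpha>)) m n"
    for w m n
    by (simp add: reach_def lookup_add pos_part_minus_neg_part[of \<alpha>] algebra_simps)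
  have \<beta>_move: "reach (w + expo (neg_part \<beta>)) m (n - 1) \<longleftrightarrow> reach (w + expo (pos_part \<beta>)) m n"
    for w m n
    by (simp add: reach_def lookup_add pos_part_minus_neg_part[of \<beta>] algebra_simps)
  have no_exit: "\<not> reach (w + expo (pos_part \<beta>)) m 0" for w m
  proof
    assume r: "reach (w + expo (pos_part \<beta>)) m 0"
    have "m \<ge> 0"
    proof (rule ccontr)
      assume "\<not> m \<ge> 0"
      then have "m * \<alpha> $ i \<le> - 1 * \<alpha> $ i"
        using i by (intro mult_right_mono) auto
      \<comment> \<open>Here \<beta> is negative, so \<open>g\<close> is too small at
        \<open>i\<close> to absorb even one subtraction of \<alpha>.\<close>
      moreover have "int (g $ i) < \<alpha> $ i"
        using i by (simp add: g_def pos_part_def)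
      ultimately show False
        using r[unfolded reach_def, rule_format, of i] by simp
    qed
    then have "m * \<alpha> $ j \<le> 0"
      using j by (simp add: mult_nonneg_nonpos)
    \<comment> \<open>At \<open>j\<close> the exponent would be at most \<open>g $ j\<close>, yet it
      contains \<open>pos_part \<beta>\<close>.\<close>
    moreover have "int (g $ j) < \<beta> $ j" "int (pos_part \<beta> $ j) = \<beta> $ j"
      using j by (simp_all add: g_def pos_part_def)
    ultimately show False
      using r[unfolded reach_def, rule_format, of j] by (simp add: lookup_add)
  qed
  have "w + expo (pos_part \<alpha>) \<in> S \<longleftrightarrow> w + expo (neg_part \<alpha>) \<in> S" for w
  proof -
    have "(\<exists>m. reach (w + expo (pos_part \<alpha>)) m n) \<longleftrightarrow> (\<exists>m. reach (w + expo (neg_part \<alpha>)) m n)" for n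
      using \<alpha>_move[of w] by (metis add_diff_cancel)
    then show ?thesis unfolding S_def by blast
  qed
  moreover have "w + expo (pos_part \<beta>) \<in> S \<longleftrightarrow> w + expo (neg_part \<beta>) \<in> S" for w
  proof
    assume "w + expo (pos_part \<beta>) \<in> S"
    then obtain m n where "n \<ge> 0" and r: "reach (w + expo (pos_part \<beta>)) m n"
      by (auto simp: S_def)
    moreover have "n \<noteq> 0" using r no_exit by metis
    ultimately have "n - 1 \<ge> 0" "reach (w + expo (neg_part \<beta>)) m (n - 1)"
      using \<beta>_move by auto
    then show "w + expo (neg_part \<beta>) \<in> S" unfolding S_def by blast
  next
    assume "w + expo (neg_part \<beta>) \<in> S"
    then obtain m n where "n \<ge> 0" "reach (w + expo (neg_part \<beta>)) m n"
      by (auto simp: S_def)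
    then have "n + 1 \<ge> 0" "reach (w + expo (pos_part \<beta>)) m (n + 1)"
      using \<beta>_move[of w m "n + 1"] by auto
    then show "w + expo (pos_part \<beta>) \<in> S" unfolding S_def by blast
  qed
  ultimately have "coeff_sum S ?f = 0"
    using mem unfolding monomial_eq_single by (intro coeff_sum_ideal_span)
  moreover have "expo (pos_part (\<alpha> + \<beta>)) \<in> S"
  proof -
    have "reach (expo (pos_part (\<alpha> + \<beta>))) 0 0" by (simp add: reach_def g_def)
    then show ?thesis unfolding S_def by blast
  qed
  moreover have "expo (neg_part (\<alpha> + \<beta>)) \<notin> S"
  proof
    assume "expo (neg_part (\<alpha> + \<beta>)) \<in> S"
    then obtain m n where "n \<ge> 0" and r: "reach (expo (neg_part (\<alpha> + \<beta>))) m n"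
      by (auto simp: S_def)
    \<comment> \<open>Replacing the difference of the two parts of \<alpha> + \<beta> by the sum
      itself raises both coefficients by one; independence then forces \<open>n = - 1\<close>, just
      outside \<open>S\<close>.\<close>
    have "(m + 1) * \<alpha> $ k + (n + 1) * \<beta> $ k = 0" for k
      using r[unfolded reach_def, rule_format, of k] pos_part_minus_neg_part[of "\<alpha> + \<beta>" k]
      by (simp add: g_def algebra_simps)
    then have "n + 1 = 0" by (rule int_vec_independent_pairD[OF assms(1,2)])
    with \<open>n \<ge> 0\<close> show False by simp
  qed
  ultimately show False
    by (simp add: monomial_eq_single coeff_sum_diff coeff_sum_single)
qed

lemma binomial_in_span_if_disjoint:
  fixes \<alpha> \<beta> :: "int ^ 'n::finite"
  assumes "supp (pos_part \<alpha>) \<inter> supp (neg_part \<beta>) = {}"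
  shows "(monomial (pos_part (\<alpha> + \<beta>)) - monomial (neg_part (\<alpha> + \<beta>)) :: ('n, 'k::comm_ring_1) mpoly)
    \<in> ideal.span {monomial (pos_part \<alpha>) - monomial (neg_part \<alpha>),
                  monomial (pos_part \<beta>) - monomial (neg_part \<beta>)}"
proof (rule binomial_in_span_if_le)
  fix i
  \<comment> \<open>So \<beta> cannot lower a positive entry of \<alpha>, nor \<alpha> raise a
    negative entry of \<beta>.\<close>
  have "\<not> (\<alpha> $ i > 0 \<and> \<beta> $ i < 0)"
    using assms by (auto simp: supp_def pos_part_def neg_part_def)
  then show "pos_part \<alpha> $ i \<le> pos_part (\<alpha> + \<beta>) $ i" "neg_part \<beta> $ i \<le> neg_part (\<alpha> + \<beta>) $ i"
    by (auto simp: pos_part_def neg_part_def)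
  show "int (pos_part (\<alpha> + \<beta>) $ i) - int (neg_part (\<alpha> + \<beta>) $ i) = \<alpha> $ i + \<beta> $ i"
    by (simp flip: pos_part_minus_neg_part)
qed

theorem lemma3p2:
  fixes \<alpha> \<beta> \<gamma> :: "int ^ 'n::finite"
  assumes "\<alpha> \<noteq> \<beta>" and "int_vec.independent {\<alpha>, \<beta>}"
    and "\<gamma> = \<alpha> + \<beta>"
    and "\<exists>i. \<alpha> $ i > 0" and "\<exists>i. \<alpha> $ i < 0"
    and "\<exists>i. \<beta> $ i > 0" and "\<exists>i. \<beta> $ i < 0"
    and "\<exists>i. \<gamma> $ i > 0" and "\<exists>i. \<gamma> $ i < 0"
  shows "(monomial (pos_part \<gamma>) - monomial (neg_part \<gamma>) :: ('n, 'k::{alg_closed_field, field_char_0}) mpoly)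
           \<in> ideal.span {monomial (pos_part \<alpha>) - monomial (neg_part \<alpha>),
                          monomial (pos_part \<beta>) - monomial (neg_part \<beta>)}
         \<longleftrightarrow> supp (pos_part \<alpha>) \<inter> supp (neg_part \<beta>) = {} \<or>
             supp (neg_part \<alpha>) \<inter> supp (pos_part \<beta>) = {}"
    (is "?mem \<longleftrightarrow> ?P \<or> ?Q")
proof
  assume ?mem
  show "?P \<or> ?Q"
  proof (rule ccontr)
    assume "\<not> (?P \<or> ?Q)"
    then obtain i j where "\<alpha> $ i > 0" "\<beta> $ i < 0" "\<alpha> $ j < 0" "\<beta> $ j > 0"
      by (auto simp: supp_def pos_part_def neg_part_def split: if_splits)
    from binomial_notin_span[OF assms(1,2) this] \<open>?mem\<close> show False
      unfolding assms(3) by blast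
  qed
next
  assume "?P \<or> ?Q"
  then show ?mem
  proof
    assume ?P
    then show ?thesis unfolding assms(3) by (rule binomial_in_span_if_disjoint)
  next
    assume ?Q
    \<comment> \<open>Exchanging \<alpha> and \<beta> preserves the sum and the generating set, so
      the first case applies.\<close>
    then have "supp (pos_part \<beta>) \<inter> supp (neg_part \<alpha>) = {}" by blast
    from binomial_in_span_if_disjoint[OF this, where 'k = 'k] show ?thesis
      unfolding assms(3) by (simp only: insert_commute add.commute)
  qed
qed

end
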